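(* Let $p\geq 3$ be a prime and $n\ge 1$ an integer. Let $A=A_{Pow^{\ast}(\mathbb{Z}_{p^{n}})}$ be the adjacency matrix of the punctured power digraph of the cyclic group of order $p^n$, and let $I$ be the identity matrix of size $p^n-1$. The Smith normal form of the integer matrix $I-A^{tr}$ is $$\mathrm{diag}\big(\underbrace{1,\dots,1}_{n\ \text{times}},\ \underbrace{2,\dots,2}_{p^n-2n-1\ \text{times}},\ \underbrace{4,\dots,4}_{n-1\ \text{times}},\ |\eta|\big),\qquad \eta=\frac{\prod_{i=1}^{n}\big(2-\varphi(p^i)\big)2^{\varphi(p^i)-1}}{2^{p^n-3}},$$ where $\varphi$ is Euler's totient function.
   Context: The punctured power digraph $Pow^{\ast}(G)$ of a group $G$ has the non-identity elements of $G$ as vertices, with exactly one directed edge from $x$ to $y$ whenever $x\ne y$ and $y=x^m$ for some integer $m$ (and no other edges). The adjacency matrix of a finite digraph is the square integer matrix indexed by the vertices whose $(u,v)$-entry is the number of edges from $u$ to $v$. The Smith normal form of an integer matrix $M$ of rank $r$ is the diagonal matrix $\mathrm{diag}(s_1,\dots,s_r,0,\dots,0)$ equivalent to $M$ over $\mathbb{Z}$ (i.e. obtained by multiplying $M$ on the left and right by invertible integer matrices) such that $s_1\cdots s_k$ is the greatest common divisor of the determinants of the $k\times k$ submatrices of $M$ for $1\le k\le r$. *)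

theory Defs
  imports
    "HOL-Algebra.Elementary_Groups"
    "HOL-Number_Theory.Totient"
    "Graph_Theory.Pair_Digraph"
    "Jordan_Normal_Form.Determinant"
    "Jordan_Normal_Form.DL_Submatrix"
    "Jordan_Normal_Form.DL_Rank"
begin

definition punctured_power_digraph :: "('a, 'b) monoid_scheme \<Rightarrow> 'a pair_pre_digraph" where
  "punctured_power_digraph G =
     (let V = carrier G - {\<one>\<^bsub>G\<^esub>}
      in \<lparr> pverts = V,
           parcs = {(x, y). x \<in> V \<and> y \<in> V \<and> x \<noteq> y \<and> (\<exists>m::int. y = x [^]\<^bsub>G\<^esub> m)} \<rparr>)"

text \<open>Matrices are indexed by initial segments of the naturals, so the adjacency matrix is taken
  with respect to a list that enumerates the vertices.\<close>

definition adjacency_matrix :: "('a, 'b) pre_digraph \<Rightarrow> 'a list \<Rightarrow> int mat" where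
  "adjacency_matrix D vs = mat (length vs) (length vs)
     (\<lambda>(i, j). int (card {e \<in> arcs D. tail D e = vs ! i \<and> head D e = vs ! j}))"

text \<open>The rank of an integer matrix is its rank over the rationals.\<close>

definition int_mat_rank :: "int mat \<Rightarrow> nat" where
  "int_mat_rank M = vec_space.rank (dim_row M) (map_mat rat_of_int M)"

definition minors :: "nat \<Rightarrow> int mat \<Rightarrow> int set" where
  "minors k M = {det (submatrix M I J) | I J.
     I \<subseteq> {..<dim_row M} \<and> J \<subseteq> {..<dim_col M} \<and> card I = k \<and> card J = k}"

text \<open>The condition on the greatest common divisors determines the diagonal entries, including
  their signs, since \<^const>\<open>Gcd\<close> on the integers is nonnegative.\<close>

definition is_smith_normal_form :: "int mat \<Rightarrow> int mat \<Rightarrow> bool" where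
  "is_smith_normal_form M S \<longleftrightarrow>
     S \<in> carrier_mat (dim_row M) (dim_col M) \<and>
     diagonal_mat S \<and>
     (\<exists>P Q. P \<in> carrier_mat (dim_row M) (dim_row M) \<and> invertible_mat P \<and>
            Q \<in> carrier_mat (dim_col M) (dim_col M) \<and> invertible_mat Q \<and>
            S = P * M * Q) \<and>
     (\<forall>k \<in> {1..int_mat_rank M}. (\<Prod>i<k. S $$ (i, i)) = Gcd (minors k M)) \<and>
     (\<forall>i. int_mat_rank M \<le> i \<and> i < min (dim_row M) (dim_col M) \<longrightarrow> S $$ (i, i) = 0)"

definition eta :: "nat \<Rightarrow> nat \<Rightarrow> rat" where
  "eta p n = (\<Prod>i = 1..n. (2 - of_nat (totient (p ^ i))) * 2 ^ (totient (p ^ i) - 1))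
               / 2 ^ (p ^ n - 3)"

end

theory Submission
  imports Defs "Jordan_Normal_Form.DL_Rank_Submatrix"
begin

text \<open>
  Call the exponent \<open>i\<close> of the order \<open>p ^ i\<close> of a vertex its level. An edge runs from \<open>x\<close> to
  \<open>y \<noteq> x\<close> exactly when the level of \<open>y\<close> is at most that of \<open>x\<close>, so \<open>M = I - A\<^sup>T\<close> has the entries
  \<open>2 \<delta> - [lev j \<le> lev k]\<close>. It depends only on the levels, whose sizes \<open>\<phi>(p ^ i)\<close> are even
  because \<open>p\<close> is odd.

  The proof writes down two bases of the integer lattice, vectors \<open>v\<close> and \<open>l\<close> with \<open>M v = s l\<close>, where
  \<open>s\<close> runs through the claimed diagonal. Fix two vertices \<open>\<alpha> i\<close> and \<open>\<beta> i\<close> in every level. Let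
  \<open>e(k)\<close> be a unit vector, \<open>c(i) = e(\<beta> i)\<close> with \<open>c(0) = 0\<close>, let \<open>1\<^sub>i\<close> be the indicator vector of level
  \<open>i\<close> and \<open>1\<^sub>\<le>\<^sub>i\<close> that of all levels up to \<open>i\<close>, and put \<open>b(i) = 1 - \<phi>(p ^ i) / 2\<close>. Then

  \<^item> \<open>M c(i) = 2 c(i) - 1\<^sub>\<le>\<^sub>i\<close> accounts for the \<open>n\<close> factors 1;
  \<^item> \<open>M (e(k) - c(i)) = 2 (e(k) - c(i))\<close> for the remaining vertices \<open>k\<close> of level \<open>i\<close>, other than
    \<open>\<alpha> i\<close> and \<open>\<beta> i\<close>, accounts for the factors 2;
  \<^item> \<open>g(i) = 1\<^sub>i + 2 b(i) c(i) - 2 c(i - 1)\<close> satisfies \<open>M g(i) = 4 (b(i) c(i) - c(i - 1))\<close>, and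
    \<open>i = 2, \<dots>, n\<close> accounts for the factors 4;
  \<^item> the sum of all \<open>b(1) \<cdots> b(i - 1) g(i)\<close> telescopes under \<open>M\<close> to
    \<open>4 b(1) \<cdots> b(n) c(n)\<close>. Up to sign this accounts for the last entry, since
    \<open>\<eta> = 4 b(1) \<cdots> b(n)\<close> by \<open>eta_eq\<close>.

  That the vectors \<open>v\<close> and the vectors \<open>l\<close> generate all unit vectors is \<open>dom_basis\<close> and \<open>cod_basis\<close>.
  The lemma \<open>smith_normal_form_from_bases\<close> turns such data into a Smith normal form. Its gcd
  condition rests on the fact that the gcd of the \<open>k\<close>-minors is unchanged under unimodular
  equivalence, \<open>Gcd_minors_dvd_mult\<close>, which is a weak form of the Cauchy--Binet formula.\<close>

section \<open>Greatest common divisors of minors\<close>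

lemma submatrix_index_within:
  assumes "I \<subseteq> {..<dim_row M}" "J \<subseteq> {..<dim_col M}" "i < card I" "j < card J"
  shows "submatrix M I J $$ (i, j) = M $$ (pick I i, pick J j)"
    and "pick I i < dim_row M" and "pick J j < dim_col M"
proof -
  have "{i. i < dim_row M \<and> i \<in> I} = I" "{j. j < dim_col M \<and> j \<in> J} = J"
    using assms by auto
  then show "submatrix M I J $$ (i, j) = M $$ (pick I i, pick J j)"
    using assms by (simp add: submatrix_index)
  show "pick I i < dim_row M" "pick J j < dim_col M"
    using pick_in_set[of i I] pick_in_set[of j J] assms by auto
qed

lemma submatrix_carrier_within:
  assumes "I \<subseteq> {..<dim_row M}" "J \<subseteq> {..<dim_col M}"
  shows "submatrix M I J \<in> carrier_mat (card I) (card J)"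
proof -
  have "{i. i < dim_row M \<and> i \<in> I} = I" "{j. j < dim_col M \<and> j \<in> J} = J"
    using assms by auto
  then show ?thesis
    by (metis carrier_matI dim_submatrix)
qed

text \<open>Transposition lets the Gcd estimate for multiplication from the right be read off from the one
  for multiplication from the left.\<close>

lemma minors_transpose: "minors k (transpose_mat M) = minors k M"
proof -
  have sub: "minors k (transpose_mat M) \<subseteq> minors k M" for M :: "int mat"
  proof
    fix x assume "x \<in> minors k (transpose_mat M)"
    then obtain I J where IJ: "I \<subseteq> {..<dim_col M}" "J \<subseteq> {..<dim_row M}" "card I = k" "card J = k"
      and x: "x = det (submatrix (transpose_mat M) I J)"
      unfolding minors_def by auto
    have S: "submatrix M J I \<in> carrier_mat k k"
      using submatrix_carrier_within[of J M I] IJ by simp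
    have T: "submatrix (transpose_mat M) I J \<in> carrier_mat k k"
      using submatrix_carrier_within[of I "transpose_mat M" J] IJ by simp
    have "submatrix (transpose_mat M) I J = transpose_mat (submatrix M J I)"
      using S T IJ submatrix_index_within[of I "transpose_mat M" J] submatrix_index_within[of J M I]
      by (intro eq_matI) auto
    then have "x = det (submatrix M J I)"
      using x det_transpose[OF S] by simp
    then show "x \<in> minors k M"
      unfolding minors_def using IJ by auto
  qed
  from sub[of M] sub[of "transpose_mat M"] show ?thesis by simp
qed

text \<open>The rows chosen by \<open>f\<close> may be out of order or repeated. A repetition makes the determinant
  vanish; otherwise the matrix is a row permutation of a genuine submatrix, so its determinant is
  a minor up to sign.\<close>

lemma dvd_det_row_selection:
  assumes B: "B \<in> carrier_mat n c" and J: "J \<subseteq> {..<c}" "card J = k"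
    and f: "\<And>i. i < k \<Longrightarrow> f i < n"
    and g: "\<And>x. x \<in> minors k B \<Longrightarrow> g dvd x"
  shows "g dvd det (mat k k (\<lambda>(i, j). B $$ (f i, pick J j)))" (is "g dvd det ?S")
proof (cases "inj_on f {0..<k}")
  case False
  then obtain i j where ij: "i \<noteq> j" "i < k" "j < k" "f i = f j"
    unfolding inj_on_def by auto
  have "det ?S = 0"
    by (rule det_identical_rows[of _ k i j]) (use ij in \<open>auto intro!: eq_vecI\<close>)
  then show ?thesis by simp
next
  case True
  define K where "K = f ` {0..<k}"
  have K: "K \<subseteq> {..<n}" "card K = k" "finite K"
    using f card_image[OF True] by (auto simp: K_def)
  \<comment> \<open>Sorting the selected rows: \<open>p i\<close> is the position of \<open>f i\<close> in \<open>K\<close>.\<close>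
  define p where "p = (\<lambda>i. if i < k then card {a \<in> K. a < f i} else i)"
  have pick: "pick K (p i) = f i" if "i < k" for i
    using pick_card_in_set[of "f i" K] that by (simp add: p_def K_def)
  have lt: "p i < k" if "i < k" for i
  proof -
    have "{a \<in> K. a < f i} \<subset> K" using that by (auto simp: K_def)
    then show ?thesis using psubset_card_mono[OF K(3)] K(2) that by (simp add: p_def)
  qed
  have inj: "inj_on p {0..<k}"
    by (rule inj_onI) (metis True atLeastLessThan_iff inj_on_def pick)
  have perm: "p permutes {0..<k}"
    using inj_on_nat_permutes[OF inj] lt by (auto simp: p_def)
  have S: "submatrix B K J \<in> carrier_mat k k"
    using submatrix_carrier_within[of K B J] K J B by auto
  have "?S = mat k k (\<lambda>(i, j). submatrix B K J $$ (p i, j))"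
    using submatrix_index_within[of K B J] K J B pick lt by (intro eq_matI) auto
  then have "det ?S = signof p * det (submatrix B K J)"
    using det_permute_rows[OF S perm] by simp
  moreover have "det (submatrix B K J) \<in> minors k B"
    unfolding minors_def using K J B by blast
  ultimately show ?thesis using g by simp
qed

text \<open>This is the divisibility content of the Cauchy--Binet formula. Every row of a submatrix of
  \<open>A * B\<close> is an integer combination of rows of \<open>B\<close>, and expanding the determinant by
  multilinearity in all rows leaves an integer combination of determinants of row selections
  of \<open>B\<close>.\<close>

lemma dvd_minors_mult_left:
  assumes A: "A \<in> carrier_mat m n" and B: "B \<in> carrier_mat n c"
    and g: "\<And>x. x \<in> minors k B \<Longrightarrow> g dvd x"
    and x: "x \<in> minors k (A * B)"
  shows "g dvd x"
proof -
  obtain I J where IJ: "I \<subseteq> {..<m}" "J \<subseteq> {..<c}" "card I = k" "card J = k"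
    and x: "x = det (submatrix (A * B) I J)"
    using x A B unfolding minors_def by auto
  define A' where "A' = mat k n (\<lambda>(i, l). A $$ (pick I i, l))"
  define B' where "B' = mat n k (\<lambda>(l, j). B $$ (l, pick J j))"
  have A': "A' \<in> carrier_mat k n" and B': "B' \<in> carrier_mat n k"
    by (auto simp: A'_def B'_def)
  have "submatrix (A * B) I J = A' * B'"
  proof (rule eq_matI)
    fix i j assume "i < dim_row (A' * B')" "j < dim_col (A' * B')"
    then have ij: "i < k" "j < k" by (auto simp: A'_def B'_def)
    have "pick I i < m" "pick J j < c"
      using submatrix_index_within(2,3)[of I "A * B" J i j] ij IJ A B by auto
    then show "submatrix (A * B) I J $$ (i, j) = (A' * B') $$ (i, j)"
      using submatrix_index_within(1)[of I "A * B" J i j] ij IJ A B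
      by (auto simp: A'_def B'_def scalar_prod_def)
  qed (use submatrix_carrier_within[of I "A * B" J] IJ A B in \<open>auto simp: A'_def B'_def\<close>)
  then have "x = (\<Sum>f | (\<forall>i\<in>{0..<k}. f i \<in> {0..<n}) \<and> (\<forall>i. i \<notin> {0..<k} \<longrightarrow> f i = i).
      det (mat\<^sub>r k k (\<lambda>i. A' $$ (i, f i) \<cdot>\<^sub>v row B' (f i))))"
    unfolding x mat_mul_finsum_alt[OF A' B']
    by (simp only:) (rule det_linear_rows_sum, use B' in auto)
  also have "g dvd \<dots>"
  proof (rule dvd_sum)
    fix f assume "f \<in> {f. (\<forall>i\<in>{0..<k}. f i \<in> {0..<n}) \<and> (\<forall>i. i \<notin> {0..<k} \<longrightarrow> f i = i)}"
    then have f: "f i < n" if "i < k" for i using that by auto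
    have "det (mat\<^sub>r k k (\<lambda>i. A' $$ (i, f i) \<cdot>\<^sub>v row B' (f i)))
        = (\<Prod>i = 0..<k. A' $$ (i, f i)) * det (mat\<^sub>r k k (\<lambda>i. row B' (f i)))"
      by (rule det_rows_mul) (use B' in auto)
    also have "mat\<^sub>r k k (\<lambda>i. row B' (f i)) = mat k k (\<lambda>(i, j). B $$ (f i, pick J j))"
      using f by (intro eq_matI) (auto simp: B'_def)
    finally show "g dvd det (mat\<^sub>r k k (\<lambda>i. A' $$ (i, f i) \<cdot>\<^sub>v row B' (f i)))"
      using dvd_det_row_selection[OF B IJ(2,4) f g] by simp
  qed
  finally show ?thesis .
qed

lemma dvd_minors_mult_right:
  assumes A: "A \<in> carrier_mat m n" and B: "B \<in> carrier_mat n c"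
    and g: "\<And>x. x \<in> minors k A \<Longrightarrow> g dvd x"
    and x: "x \<in> minors k (A * B)"
  shows "g dvd x"
proof -
  have "x \<in> minors k (transpose_mat B * transpose_mat A)"
    using x transpose_mult[OF A B] minors_transpose[of k "A * B"] by simp
  then show ?thesis
    using dvd_minors_mult_left[of "transpose_mat B" c n "transpose_mat A" m k g] A B g
    by (simp add: minors_transpose)
qed

text \<open>Applied to a matrix equivalence in both directions, this shows that the gcd of the \<open>k\<close>-minors is
  an invariant of the equivalence class.\<close>

lemma Gcd_minors_dvd_mult:
  assumes "P \<in> carrier_mat m m" "M \<in> carrier_mat m n" "Q \<in> carrier_mat n n"
  shows "Gcd (minors k M) dvd Gcd (minors k (P * M * Q))"
proof (rule Gcd_greatest)
  fix x assume x: "x \<in> minors k (P * M * Q)"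
  show "Gcd (minors k M) dvd x"
  proof (rule dvd_minors_mult_right[OF _ assms(3) _ x])
    show "P * M \<in> carrier_mat m n" using assms by simp
    show "Gcd (minors k M) dvd y" if "y \<in> minors k (P * M)" for y
      by (rule dvd_minors_mult_left[OF assms(1,2) _ that]) (rule Gcd_dvd)
  qed
qed

text \<open>The \<open>i\<close>-th smallest element of an index set is at least \<open>i\<close>, so along a divisibility chain every
  entry in row \<open>i\<close> of a submatrix is a multiple of \<open>s i\<close>. Hence the product of the first \<open>k\<close>
  entries divides every \<open>k\<close>-minor, and it is itself the leading one.\<close>

lemma Gcd_minors_diag:
  fixes s :: "nat \<Rightarrow> int"
  assumes chain: "\<And>i j. i \<le> j \<Longrightarrow> j < N \<Longrightarrow> s i dvd s j"
    and nonneg: "\<And>i. i < N \<Longrightarrow> 0 \<le> s i" and k: "k \<le> N"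
  shows "Gcd (minors k (mat_diag N s)) = (\<Prod>i<k. s i)"
proof (rule zdvd_antisym_nonneg)
  have pick: "pick {..<k} i = i" if "i < k" for i
  proof -
    have "{a \<in> {..<k}. a < i} = {..<i}" using that by auto
    then show ?thesis using pick_card_in_set[of i "{..<k}"] that by simp
  qed
  have S: "submatrix (mat_diag N s) {..<k} {..<k} \<in> carrier_mat k k"
    using submatrix_carrier_within[of "{..<k}" "mat_diag N s" "{..<k}"] k by (simp add: mat_diag_def)
  have "submatrix (mat_diag N s) {..<k} {..<k} = mat_diag k s"
  proof (rule eq_matI)
    fix i j assume "i < dim_row (mat_diag k s)" "j < dim_col (mat_diag k s)"
    then have "i < k" "j < k" by (auto simp: mat_diag_def)
    then show "submatrix (mat_diag N s) {..<k} {..<k} $$ (i, j) = mat_diag k s $$ (i, j)"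
      using submatrix_index_within(1)[of "{..<k}" "mat_diag N s" "{..<k}" i j] k
      by (simp add: mat_diag_def pick)
  qed (use S in \<open>auto simp: mat_diag_def\<close>)
  moreover have "det (mat_diag k s) = (\<Prod>i<k. s i)"
    by (subst det_upper_triangular[of _ k])
       (auto simp: mat_diag_def diag_mat_def prod.list_conv_set_nth atLeast0LessThan)
  ultimately have "(\<Prod>i<k. s i) \<in> minors k (mat_diag N s)"
    unfolding minors_def using k
    by (auto simp: mat_diag_def intro!: exI[of _ "{..<k}"])
  then show "Gcd (minors k (mat_diag N s)) dvd (\<Prod>i<k. s i)" by (rule Gcd_dvd)
  show "(\<Prod>i<k. s i) dvd Gcd (minors k (mat_diag N s))"
  proof (rule Gcd_greatest)
    fix x assume "x \<in> minors k (mat_diag N s)"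
    then obtain I J where IJ: "I \<subseteq> {..<N}" "J \<subseteq> {..<N}" "card I = k" "card J = k"
      and x: "x = det (submatrix (mat_diag N s) I J)"
      unfolding minors_def by (auto simp: mat_diag_def)
    have S: "submatrix (mat_diag N s) I J \<in> carrier_mat k k"
      using submatrix_carrier_within[of I "mat_diag N s" J] IJ by (simp add: mat_diag_def)
    have entry: "s i dvd submatrix (mat_diag N s) I J $$ (i, j)" if "i < k" "j < k" for i j
    proof -
      have "{a \<in> I. a < pick I i} \<subseteq> {..<pick I i}" by auto
      then have "i \<le> pick I i"
        using card_mono[of "{..<pick I i}" "{a \<in> I. a < pick I i}"] card_pick[of i I] IJ that by simp
      then show ?thesis
        using submatrix_index_within[of I "mat_diag N s" J i j] IJ that chain[of i "pick I i"]
        by (auto simp: mat_diag_def)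
    qed
    show "(\<Prod>i<k. s i) dvd x"
      unfolding x det_def'[OF S]
    proof (intro dvd_sum dvd_mult)
      fix p assume "p \<in> {p. p permutes {0..<k}}"
      then have "p i < k" if "i < k" for i
        using that permutes_in_image[of p "{0..<k}" i] by simp
      then show "(\<Prod>i<k. s i) dvd (\<Prod>i = 0..<k. submatrix (mat_diag N s) I J $$ (i, p i))"
        unfolding lessThan_atLeast0 by (intro prod_dvd_prod) (auto intro: entry)
    qed
  qed
  show "0 \<le> (\<Prod>i<k. s i)" using nonneg k by (intro prod_nonneg) auto
qed auto

section \<open>Smith normal forms from pairs of lattice bases\<close>

text \<open>Vectors of length \<open>N\<close> are represented by functions on the natural numbers of which only the first
  \<open>N\<close> values matter; the condition is imposed on these values alone, so that no support
  condition has to be carried through the computations.\<close>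

definition int_span :: "nat \<Rightarrow> (nat \<Rightarrow> int) list \<Rightarrow> (nat \<Rightarrow> int) set" where
  "int_span N fs = {f. \<exists>c. \<forall>j<N. f j = (\<Sum>i<length fs. c i * (fs ! i) j)}"

lemma int_span_base:
  assumes "f \<in> set fs"
  shows "f \<in> int_span N fs"
proof -
  obtain k where k: "k < length fs" "fs ! k = f"
    using assms by (auto simp: in_set_conv_nth)
  have "f j = (\<Sum>i<length fs. (if i = k then 1 else 0) * (fs ! i) j)" for j
    using k by (simp add: if_distrib[of "\<lambda>x. x * _"] cong: if_cong)
  then show ?thesis unfolding int_span_def mem_Collect_eq
    by (intro exI[of _ "\<lambda>i. if i = k then 1 else 0"]) blast
qed

lemma int_span_lincomb:
  assumes "f \<in> int_span N fs" "g \<in> int_span N fs"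
    and "\<And>j. j < N \<Longrightarrow> h j = a * f j + b * g j"
  shows "h \<in> int_span N fs"
proof -
  obtain c d where c: "\<forall>j<N. f j = (\<Sum>i<length fs. c i * (fs ! i) j)"
    and d: "\<forall>j<N. g j = (\<Sum>i<length fs. d i * (fs ! i) j)"
    using assms(1,2) unfolding int_span_def by blast
  have "\<forall>j<N. h j = (\<Sum>i<length fs. (a * c i + b * d i) * (fs ! i) j)"
    using assms(3) c d by (simp add: sum_distrib_left sum.distrib algebra_simps)
  then show ?thesis unfolding int_span_def mem_Collect_eq
    by (intro exI[of _ "\<lambda>i. a * c i + b * d i"]) simp
qed

lemma int_span_zero:
  assumes "\<And>j. j < N \<Longrightarrow> f j = 0"
  shows "f \<in> int_span N fs"
  using assms unfolding int_span_def by (auto intro!: exI[of _ "\<lambda>_. 0"])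

lemma int_span_sum:
  assumes "finite K" and f: "\<And>k. k \<in> K \<Longrightarrow> f k \<in> int_span N fs"
  shows "(\<lambda>j. \<Sum>k\<in>K. a k * f k j) \<in> int_span N fs"
  using assms(1) f
proof (induction K rule: finite_induct)
  case empty
  then show ?case by (simp add: int_span_zero)
next
  case (insert x K)
  then have "f x \<in> int_span N fs" "(\<lambda>j. \<Sum>k\<in>K. a k * f k j) \<in> int_span N fs" by auto
  then show ?case
    by (rule int_span_lincomb[where a = "a x" and b = 1]) (use insert.hyps in simp)
qed

text \<open>Over a commutative ring a right inverse makes the determinant a unit, and then the adjugate
  supplies a left inverse.\<close>

lemma right_inverse_is_left_inverse:
  fixes A :: "'a :: comm_ring_1 mat"
  assumes A: "A \<in> carrier_mat n n" and B: "B \<in> carrier_mat n n" and AB: "A * B = 1\<^sub>m n"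
  shows "B * A = 1\<^sub>m n"
proof -
  define C where "C = det B \<cdot>\<^sub>m adj_mat A"
  have C: "C \<in> carrier_mat n n" using adj_mat(1)[OF A] by (simp add: C_def)
  have "det B * det A = 1"
    using det_mult[OF A B] AB by (simp add: mult.commute)
  moreover have "C * A = det B \<cdot>\<^sub>m (det A \<cdot>\<^sub>m 1\<^sub>m n)"
    unfolding C_def mult_smult_assoc_mat[OF adj_mat(1)[OF A] A] adj_mat(3)[OF A] ..
  ultimately have CA: "C * A = 1\<^sub>m n"
    by (intro eq_matI) (auto simp flip: mult.assoc)
  have "C = C * (A * B)" unfolding AB using C by simp
  also have "\<dots> = B" using CA B by (simp flip: assoc_mult_mat[OF C A B])
  finally show ?thesis using CA by simp
qed

text \<open>If \<open>N\<close> integer vectors span all unit vectors, the coefficients form an inverse of the matrix with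
  these vectors as columns. Unimodularity is thus checked by generating the unit vectors, without
  computing a determinant.\<close>

lemma spanning_columns_inverse:
  fixes fs :: "(nat \<Rightarrow> int) list"
  assumes len: "length fs = N"
    and unit: "\<And>k. k < N \<Longrightarrow> (\<lambda>j. of_bool (j = k)) \<in> int_span N fs"
  obtains W where "W \<in> carrier_mat N N"
    "mat N N (\<lambda>(j, i). (fs ! i) j) * W = 1\<^sub>m N" "W * mat N N (\<lambda>(j, i). (fs ! i) j) = 1\<^sub>m N"
proof -
  let ?V = "mat N N (\<lambda>(j, i). (fs ! i) j)"
  have "\<forall>k\<in>{..<N}. \<exists>c. \<forall>j<N. of_bool (j = k) = (\<Sum>i<N. c i * (fs ! i) j)"
    using unit len unfolding int_span_def by auto
  from bchoice[OF this] obtain c where "\<forall>k\<in>{..<N}. \<forall>j<N. of_bool (j = k) = (\<Sum>i<N. c k i * (fs ! i) j)"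
    by blast
  then have c: "(\<Sum>i<N. c k i * (fs ! i) j) = of_bool (j = k)" if "k < N" "j < N" for j k
    using that by simp
  let ?W = "mat N N (\<lambda>(i, k). c k i)"
  have "?V * ?W = 1\<^sub>m N"
  proof (rule eq_matI)
    fix j k assume "j < dim_row (1\<^sub>m N)" "k < dim_col (1\<^sub>m N)"
    then have jk: "j < N" "k < N" by auto
    have "(?V * ?W) $$ (j, k) = (\<Sum>i<N. c k i * (fs ! i) j)"
      using jk by (simp add: scalar_prod_def lessThan_atLeast0 mult.commute)
    also have "\<dots> = of_bool (j = k)" using c[OF jk(2,1)] .
    finally show "(?V * ?W) $$ (j, k) = 1\<^sub>m N $$ (j, k)" using jk by simp
  qed auto
  then show ?thesis
    using that[of ?W] right_inverse_is_left_inverse[of ?V N ?W] by simp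
qed

text \<open>A nonzero product of the first \<open>k\<close> diagonal entries of a Smith normal form is the gcd of minors that
  do not all vanish. By this bound it forces the rank to be at least \<open>k\<close>, so that all diagonal entries
  beyond the rank are 0.\<close>

lemma int_mat_rank_ge_minor:
  assumes "x \<in> minors k M" "x \<noteq> 0"
  shows "k \<le> int_mat_rank M"
proof -
  obtain I J where IJ: "I \<subseteq> {..<dim_row M}" "J \<subseteq> {..<dim_col M}" "card I = k" "card J = k"
    and x: "x = det (submatrix M I J)"
    using assms(1) unfolding minors_def by auto
  have "submatrix (map_mat rat_of_int M) I J = map_mat rat_of_int (submatrix M I J)"
    using submatrix_carrier_within[of I M J] submatrix_carrier_within[of I "map_mat rat_of_int M" J]
      submatrix_index_within[of I M J] submatrix_index_within[of I "map_mat rat_of_int M" J] IJ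
    by (intro eq_matI) auto
  then have "det (submatrix (map_mat rat_of_int M) I J) \<noteq> 0"
    using assms(2) x by simp
  then have "card {j. j < dim_col M \<and> j \<in> J} \<le> vec_space.rank (dim_row M) (map_mat rat_of_int M)"
    by (intro vec_space.rank_gt_minor) auto
  moreover have "{j. j < dim_col M \<and> j \<in> J} = J" using IJ by auto
  ultimately show ?thesis using IJ by (simp add: int_mat_rank_def)
qed

text \<open>A triple \<open>(v, s, l)\<close> records \<open>M v = s l\<close>. If the vectors \<open>v\<close> and the vectors \<open>l\<close> are both bases of
  the integer lattice, the matrices \<open>V\<close> and \<open>L\<close> with these columns are unimodular, and
  \<open>M V = L S\<close> exhibits the diagonal matrix \<open>S\<close> of the factors as equivalent to \<open>M\<close>.\<close>

lemma smith_normal_form_from_bases: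
  fixes M :: "int mat" and D :: "((nat \<Rightarrow> int) \<times> int \<times> (nat \<Rightarrow> int)) list"
  assumes M: "M \<in> carrier_mat N N" and len: "length D = N"
    and act: "\<And>v s l j. (v, s, l) \<in> set D \<Longrightarrow> j < N \<Longrightarrow> (\<Sum>k<N. M $$ (j, k) * v k) = s * l j"
    and dom_basis: "\<And>k. k < N \<Longrightarrow> (\<lambda>j. of_bool (j = k)) \<in> int_span N (map fst D)"
    and cod_basis: "\<And>k. k < N \<Longrightarrow> (\<lambda>j. of_bool (j = k)) \<in> int_span N (map (snd \<circ> snd) D)"
    and chain: "\<And>i j. i \<le> j \<Longrightarrow> j < N \<Longrightarrow> fst (snd (D ! i)) dvd fst (snd (D ! j))"
    and nonneg: "\<And>i. i < N \<Longrightarrow> 0 \<le> fst (snd (D ! i))"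
  shows "is_smith_normal_form M (mat_diag N (\<lambda>i. fst (snd (D ! i))))"
proof -
  define s where "s = (\<lambda>i. fst (snd (D ! i)))"
  define S where "S = mat_diag N s"
  define V where "V = mat N N (\<lambda>(j, i). (map fst D ! i) j)"
  define L where "L = mat N N (\<lambda>(j, i). (map (snd \<circ> snd) D ! i) j)"
  have S: "S \<in> carrier_mat N N" and V: "V \<in> carrier_mat N N" and L: "L \<in> carrier_mat N N"
    by (auto simp: S_def V_def L_def)
  obtain V' where V': "V' \<in> carrier_mat N N" "V * V' = 1\<^sub>m N" "V' * V = 1\<^sub>m N"
    using spanning_columns_inverse[of "map fst D" N] dom_basis len unfolding V_def by auto
  obtain L' where L': "L' \<in> carrier_mat N N" "L * L' = 1\<^sub>m N" "L' * L = 1\<^sub>m N"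
    using spanning_columns_inverse[of "map (snd \<circ> snd) D" N] cod_basis len unfolding L_def by auto
  have MV: "M * V = L * S"
  proof (rule eq_matI)
    fix j i assume "j < dim_row (L * S)" "i < dim_col (L * S)"
    then have ji: "j < N" "i < N" using S L by auto
    obtain v t l where D: "D ! i = (v, t, l)" by (metis prod_cases3)
    then have "(v, t, l) \<in> set D" using ji len by (metis nth_mem)
    from act[OF this ji(1)] have "(M * V) $$ (j, i) = t * l j"
      using ji M V len D by (simp add: scalar_prod_def V_def lessThan_atLeast0)
    moreover have "(L * S) $$ (j, i) = l j * t"
      unfolding S_def mat_diag_mult_right[OF L] using ji D len by (simp add: L_def s_def)
    ultimately show "(M * V) $$ (j, i) = (L * S) $$ (j, i)" by simp
  qed (use M V L S in auto)
  have SP: "S = L' * M * V"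
  proof -
    have "L' * M * V = L' * (M * V)" by (rule assoc_mult_mat[OF L'(1) M V])
    also have "\<dots> = L' * L * S" unfolding MV by (rule assoc_mult_mat[OF L'(1) L S, symmetric])
    also have "\<dots> = S" unfolding L'(3) using S by simp
    finally show ?thesis by (rule sym)
  qed
  have MP: "M = L * S * V'"
  proof -
    have "L * S * V' = M * (V * V')" unfolding MV[symmetric] by (rule assoc_mult_mat[OF M V V'(1)])
    also have "\<dots> = M" unfolding V'(2) using M by simp
    finally show ?thesis by (rule sym)
  qed
  have inv: "invertible_mat L'" "invertible_mat V"
    unfolding invertible_mat_def inverts_mat_def square_mat.simps
    using L L' V V' by (auto intro: exI[of _ L] exI[of _ V'])
  have gcd: "(\<Prod>i<k. s i) = Gcd (minors k M)" if "k \<le> N" for k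
  proof -
    have "Gcd (minors k M) = Gcd (minors k S)"
    proof (rule zdvd_antisym_nonneg)
      show "Gcd (minors k M) dvd Gcd (minors k S)"
        using Gcd_minors_dvd_mult[OF L'(1) M V, of k] unfolding SP[symmetric] .
      show "Gcd (minors k S) dvd Gcd (minors k M)"
        using Gcd_minors_dvd_mult[OF L S V'(1), of k] unfolding MP[symmetric] .
    qed auto
    also have "\<dots> = (\<Prod>i<k. s i)"
      unfolding S_def by (rule Gcd_minors_diag) (use chain nonneg that in \<open>auto simp: s_def\<close>)
    finally show ?thesis by simp
  qed
  have rank: "int_mat_rank M \<le> N"
    using vec_space.rank_le_nc[of "map_mat rat_of_int M" N N] M by (simp add: int_mat_rank_def)
  have zero: "s i = 0" if i: "int_mat_rank M \<le> i" "i < N" for i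
  proof (rule ccontr)
    assume "s i \<noteq> 0"
    then have "s j \<noteq> 0" if "j \<le> i" for j
      using chain[of j i] that i by (auto simp: s_def)
    then have "(\<Prod>j<Suc i. s j) \<noteq> 0" by simp
    then have "Gcd (minors (Suc i) M) \<noteq> 0" using gcd[OF Suc_leI[OF i(2)]] by metis
    then have "\<not> minors (Suc i) M \<subseteq> {0}" unfolding Gcd_0_iff .
    then obtain x where "x \<in> minors (Suc i) M" "x \<noteq> 0" by blast
    from int_mat_rank_ge_minor[OF this] i show False by simp
  qed
  have "is_smith_normal_form M S"
    unfolding is_smith_normal_form_def
  proof (intro conjI ballI allI impI)
    show "S \<in> carrier_mat (dim_row M) (dim_col M)" using S M by simp
    show "\<exists>P Q. P \<in> carrier_mat (dim_row M) (dim_row M) \<and> invertible_mat P \<and>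
        Q \<in> carrier_mat (dim_col M) (dim_col M) \<and> invertible_mat Q \<and> S = P * M * Q"
      using L'(1) V inv SP carrier_matD[OF M] by metis
    show "diagonal_mat S" by (auto simp: S_def diagonal_mat_def mat_diag_def)
    fix k assume "k \<in> {1..int_mat_rank M}"
    then have k: "k \<le> N" using rank by simp
    have "(\<Prod>i<k. S $$ (i, i)) = (\<Prod>i<k. s i)"
      using k by (intro prod.cong) (auto simp: S_def mat_diag_def)
    then show "(\<Prod>i<k. S $$ (i, i)) = Gcd (minors k M)" using gcd[OF k] by simp
  next
    fix i assume "int_mat_rank M \<le> i \<and> i < min (dim_row M) (dim_col M)"
    then show "S $$ (i, i) = 0" using zero[of i] M by (auto simp: S_def mat_diag_def)
  qed
  then show ?thesis by (simp add: S_def s_def)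
qed

section \<open>Matrices that compare levels\<close>

text \<open>The matrix sees a vertex only through its level. Inside each level two vertices are singled out:
  the unit vectors at the \<open>\<beta> i\<close> carry the diagonal entries 1 of the Smith normal form, and
  \<open>\<alpha> i\<close> is the vertex whose unit vector is recovered last, from the indicator vector of its
  level.\<close>

locale level_matrix =
  fixes N n :: nat and lev h \<alpha> \<beta> :: "nat \<Rightarrow> nat"
  assumes n_pos: "1 \<le> n"
    and lev: "k < N \<Longrightarrow> lev k \<in> {1..n}"
    and card_level: "i \<in> {1..n} \<Longrightarrow> card {k. k < N \<and> lev k = i} = 2 * h i"
    and \<alpha>: "i \<in> {1..n} \<Longrightarrow> \<alpha> i < N" "i \<in> {1..n} \<Longrightarrow> lev (\<alpha> i) = i"
    and \<beta>: "i \<in> {1..n} \<Longrightarrow> \<beta> i < N" "i \<in> {1..n} \<Longrightarrow> lev (\<beta> i) = i"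
    and \<alpha>_neq_\<beta>: "i \<in> {1..n} \<Longrightarrow> \<alpha> i \<noteq> \<beta> i"
begin

definition M :: "int mat" where
  "M = mat N N (\<lambda>(j, k). 2 * of_bool (j = k) - of_bool (lev j \<le> lev k))"

definition apply_M :: "(nat \<Rightarrow> int) \<Rightarrow> nat \<Rightarrow> int" where
  "apply_M f j = (\<Sum>k<N. M $$ (j, k) * f k)"

text \<open>The value at level 0 is the zero vector. This convention lets the formulas that relate level \<open>i\<close>
  to level \<open>i - 1\<close> hold without exception at the lowest level 1.\<close>

definition unit_\<beta> :: "nat \<Rightarrow> nat \<Rightarrow> int" where
  "unit_\<beta> i j = of_bool (i \<noteq> 0 \<and> j = \<beta> i)"

definition level :: "nat \<Rightarrow> nat \<Rightarrow> int" where
  "level i j = of_bool (lev j = i)"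

definition below :: "nat \<Rightarrow> nat \<Rightarrow> int" where
  "below i j = of_bool (lev j \<le> i)"

text \<open>Level \<open>i\<close> has \<open>2 h i\<close> vertices, so its diagonal block multiplies the all-ones vector by \<open>2 b i\<close>.\<close>

definition b :: "nat \<Rightarrow> int" where
  "b i = 1 - int (h i)"

definition unit_diff :: "nat \<Rightarrow> nat \<Rightarrow> int" where
  "unit_diff k j = of_bool (j = k) - unit_\<beta> (lev k) j"

text \<open>The combination is found by eliminating the indicator vectors from \<open>M (level i)\<close>:
  \<open>below i\<close> equals \<open>2 unit_\<beta> i - M (unit_\<beta> i)\<close>, and \<open>level i = below i - below (i - 1)\<close>, so adding
  suitable multiples of \<open>unit_\<beta> i\<close> and \<open>unit_\<beta> (i - 1)\<close> leaves an image that is supported on the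
  \<open>\<beta>\<close>-vertices and divisible by 4.\<close>

definition four_vec :: "nat \<Rightarrow> nat \<Rightarrow> int" where
  "four_vec i j = level i j + 2 * b i * unit_\<beta> i j - 2 * unit_\<beta> (i - 1) j"

definition b_partial :: "nat \<Rightarrow> int" where
  "b_partial i = (\<Prod>k = 1..<i. b k)"

lemma apply_unit:
  assumes "j < N" "k < N"
  shows "apply_M (\<lambda>j. of_bool (j = k)) j = 2 * of_bool (j = k) - of_bool (lev j \<le> lev k)"
proof -
  have "apply_M (\<lambda>j. of_bool (j = k)) j = (\<Sum>k'<N. if k' = k then M $$ (j, k') else 0)"
    unfolding apply_M_def by (rule sum.cong) auto
  then show ?thesis using assms by (simp add: M_def)
qed

lemma apply_linear: "apply_M (\<lambda>j. x * f j + y * f' j) j = x * apply_M f j + y * apply_M f' j"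
  unfolding apply_M_def sum_distrib_left sum.distrib[symmetric]
  by (rule sum.cong) (auto simp: algebra_simps)

lemma apply_sum: "apply_M (\<lambda>j. \<Sum>i\<in>K. x i * f i j) j = (\<Sum>i\<in>K. x i * apply_M (f i) j)"
  unfolding apply_M_def sum_distrib_left
  by (subst sum.swap) (auto intro!: sum.cong simp: algebra_simps)

lemma apply_unit_\<beta>:
  assumes "j < N" "i \<le> n"
  shows "apply_M (unit_\<beta> i) j = 2 * unit_\<beta> i j - below i j"
proof (cases "i = 0")
  case True
  then show ?thesis using lev[OF assms(1)] by (simp add: apply_M_def unit_\<beta>_def below_def)
next
  case False
  then have i: "i \<in> {1..n}" and "unit_\<beta> i = (\<lambda>j. of_bool (j = \<beta> i))"
    using assms by (auto simp: unit_\<beta>_def)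
  then show ?thesis using apply_unit[OF assms(1) \<beta>(1)[OF i]] \<beta>(2)[OF i] by (simp add: below_def)
qed

lemma level_as_sum: "j < N \<Longrightarrow> level i j = (\<Sum>k | k < N \<and> lev k = i. of_bool (j = k))"
  by (simp add: level_def of_bool_def)

lemma apply_level:
  assumes "j < N" "i \<in> {1..n}"
  shows "apply_M (level i) j = 2 * level i j - 2 * int (h i) * below i j"
proof -
  have "apply_M (level i) j = apply_M (\<lambda>j. \<Sum>k | k < N \<and> lev k = i. 1 * of_bool (j = k)) j"
    unfolding apply_M_def by (rule sum.cong) (auto simp: level_as_sum)
  also have "\<dots> = (\<Sum>k | k < N \<and> lev k = i. 2 * of_bool (j = k) - below i j)"
    unfolding apply_sum by (rule sum.cong) (use apply_unit assms(1) in \<open>auto simp: below_def\<close>)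
  also have "\<dots> = 2 * level i j - int (card {k. k < N \<and> lev k = i}) * below i j"
    using assms(1) by (simp add: level_as_sum sum_subtractf sum_distrib_left)
  finally show ?thesis using card_level[OF assms(2)] by simp
qed

lemma apply_four_vec:
  assumes "j < N" "i \<in> {1..n}"
  shows "apply_M (four_vec i) j = 4 * (b i * unit_\<beta> i j - unit_\<beta> (i - 1) j)"
proof -
  have image_i: "apply_M (unit_\<beta> i) j = 2 * unit_\<beta> i j - below i j"
    and image_i': "apply_M (unit_\<beta> (i - 1)) j = 2 * unit_\<beta> (i - 1) j - below (i - 1) j"
    using apply_unit_\<beta>[OF assms(1)] assms(2) by auto
  have "below i j = below (i - 1) j + level i j"
    using assms(2) by (auto simp: below_def level_def)
  moreover have "apply_M (four_vec i) j
      = apply_M (level i) j + 2 * b i * apply_M (unit_\<beta> i) j - 2 * apply_M (unit_\<beta> (i - 1)) j"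
    using apply_linear[of 1 "level i" 1 "\<lambda>j. 2 * b i * unit_\<beta> i j + (-2) * unit_\<beta> (i - 1) j" j]
      apply_linear[of "2 * b i" "unit_\<beta> i" "-2" "unit_\<beta> (i - 1)" j]
    by (simp add: four_vec_def[abs_def] algebra_simps)
  ultimately show ?thesis
    using apply_level[OF assms] image_i image_i' by (simp add: b_def algebra_simps)
qed

text \<open>On the \<open>\<beta>\<close>-coordinates the matrix acts on the vectors \<open>four_vec i\<close> as 4 times a bidiagonal matrix
  with diagonal entries \<open>b i\<close> and entries -1 above the diagonal. The vector of the partial products is
  annihilated by all of its rows but the last.\<close>

lemma b_partial_telescope:
  "(\<Sum>i = 1..m. b_partial i * (b i * unit_\<beta> i j - unit_\<beta> (i - 1) j)) = b_partial (Suc m) * unit_\<beta> m j"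
proof (induction m)
  case 0
  then show ?case by (simp add: unit_\<beta>_def)
next
  case (Suc m)
  have "b_partial (Suc (Suc m)) = b_partial (Suc m) * b (Suc m)" by (simp add: b_partial_def)
  with Suc show ?case by (simp add: algebra_simps)
qed

definition unmarked :: "nat list" where
  "unmarked = filter (\<lambda>k. k \<noteq> \<alpha> (lev k) \<and> k \<noteq> \<beta> (lev k)) [0..<N]"

text \<open>This fixes the multiplicity of the factor 2.\<close>

lemma length_unmarked: "length unmarked + 2 * n = N"
proof -
  have inj: "inj_on \<alpha> {1..n}" "inj_on \<beta> {1..n}"
    by (rule inj_on_inverseI[of _ lev]; use \<alpha> \<beta> in simp)+
  have disj: "\<alpha> ` {1..n} \<inter> \<beta> ` {1..n} = {}"
  proof -
    have False if "i \<in> {1..n}" "i' \<in> {1..n}" "\<alpha> i = \<beta> i'" for i i'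
      using \<alpha>(2)[OF that(1)] \<beta>(2)[OF that(2)] \<alpha>_neq_\<beta>[OF that(1)] that(3) by simp
    then show ?thesis by blast
  qed
  have set: "{..<N} = set unmarked \<union> (\<alpha> ` {1..n} \<union> \<beta> ` {1..n})"
  proof -
    have "k \<in> set unmarked \<union> (\<alpha> ` {1..n} \<union> \<beta> ` {1..n})" if "k < N" for k
      using lev[OF that] that by (cases "k = \<alpha> (lev k)"; cases "k = \<beta> (lev k)") (auto simp: unmarked_def)
    moreover have "k < N" if "k \<in> set unmarked \<union> (\<alpha> ` {1..n} \<union> \<beta> ` {1..n})" for k
      using that \<alpha>(1) \<beta>(1) by (auto simp: unmarked_def)
    ultimately show ?thesis by blast
  qed
  have "set unmarked \<inter> (\<alpha> ` {1..n} \<union> \<beta> ` {1..n}) = {}"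
    using \<alpha>(2) \<beta>(2) unfolding unmarked_def by auto
  then have "card {..<N} = card (set unmarked) + card (\<alpha> ` {1..n} \<union> \<beta> ` {1..n})"
    unfolding set by (rule card_Un_disjoint[rotated 2]) auto
  also have "card (\<alpha> ` {1..n} \<union> \<beta> ` {1..n}) = 2 * n"
    using card_Un_disjoint[OF _ _ disj] card_image[OF inj(1)] card_image[OF inj(2)] by simp
  also have "card (set unmarked) = length unmarked"
    by (rule distinct_card) (simp add: unmarked_def)
  finally show ?thesis by simp
qed

text \<open>A common last step for both spanning proofs. The vectors \<open>unit_\<beta> i\<close> and \<open>unit_diff k\<close> give the unit
  vectors of all vertices except the \<open>\<alpha> i\<close>, and subtracting those from the indicator vector of
  a level isolates the unit vector at its \<open>\<alpha> i\<close>.\<close>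

lemma units_in_int_span:
  assumes unit_\<beta>: "\<And>i. i \<in> {1..n} \<Longrightarrow> unit_\<beta> i \<in> int_span N fs"
    and unit_diff: "\<And>k. k \<in> set unmarked \<Longrightarrow> unit_diff k \<in> int_span N fs"
    and level: "\<And>i. i \<in> {1..n} \<Longrightarrow> level i \<in> int_span N fs"
    and k: "k < N"
  shows "(\<lambda>j. of_bool (j = k)) \<in> int_span N fs"
proof -
  have other: "(\<lambda>j. of_bool (j = k)) \<in> int_span N fs" if k: "k < N" "k \<noteq> \<alpha> (lev k)" for k
  proof (cases "k = \<beta> (lev k)")
    case True
    then have "(\<lambda>j. of_bool (j = k)) = unit_\<beta> (lev k)" using lev[OF k(1)] by (auto simp: unit_\<beta>_def)
    then show ?thesis using unit_\<beta> lev[OF k(1)] by metis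
  next
    case False
    then have "k \<in> set unmarked" using k by (simp add: unmarked_def)
    from unit_diff[OF this] unit_\<beta>[OF lev[OF k(1)]] show ?thesis
      by (rule int_span_lincomb[where a = 1 and b = 1]) (simp add: unit_diff_def)
  qed
  show ?thesis
  proof (cases "k = \<alpha> (lev k)")
    case True
    let ?K = "{k'. k' < N \<and> lev k' = lev k}"
    have "(\<lambda>j. \<Sum>k'\<in>?K - {k}. 1 * of_bool (j = k')) \<in> int_span N fs"
      by (rule int_span_sum) (use other True in auto)
    with level[OF lev[OF k]] show ?thesis
    proof (rule int_span_lincomb[where a = 1 and b = "-1"])
      fix j assume "j < N"
      then show "of_bool (j = k) = 1 * level (lev k) j + - 1 * (\<Sum>k'\<in>?K - {k}. 1 * of_bool (j = k'))"
        using k sum.remove[of ?K k "\<lambda>k'. of_bool (j = k') :: int"] by (simp add: level_as_sum)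
    qed
  qed (use other k in blast)
qed

definition b_prod :: int where "b_prod = (\<Prod>i = 1..n. b i)"

text \<open>The leading coefficient \<open>b_partial 1\<close> is 1, so this vector can replace \<open>four_vec 1\<close> in a lattice basis.
  The sign makes the last diagonal entry nonnegative; it is 1 when the product of the \<open>b i\<close> vanishes,
  because a factor 0 would destroy the basis.\<close>

definition last_vec :: "nat \<Rightarrow> int" where
  "last_vec j = (if b_prod < 0 then -1 else 1) * (\<Sum>i = 1..n. b_partial i * four_vec i j)"

text \<open>Each triple \<open>(v, s, l)\<close> satisfies \<open>M v = s l\<close>; they are listed in the order of the Smith normal form,
  so that each factor divides the following ones.\<close>

definition smith_triples :: "((nat \<Rightarrow> int) \<times> int \<times> (nat \<Rightarrow> int)) list" where
  "smith_triples = map (\<lambda>i. (unit_\<beta> i, 1, \<lambda>j. 2 * unit_\<beta> i j - below i j)) [1..<Suc n]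
     @ map (\<lambda>k. (unit_diff k, 2, unit_diff k)) unmarked
     @ map (\<lambda>i. (four_vec i, 4, \<lambda>j. b i * unit_\<beta> i j - unit_\<beta> (i - 1) j)) [2..<Suc n]
     @ [(last_vec, 4 * \<bar>b_prod\<bar>, unit_\<beta> n)]"

lemma in_set_smith_triples:
  "i \<in> {1..n} \<Longrightarrow> (unit_\<beta> i, 1, \<lambda>j. 2 * unit_\<beta> i j - below i j) \<in> set smith_triples"
  "k \<in> set unmarked \<Longrightarrow> (unit_diff k, 2, unit_diff k) \<in> set smith_triples"
  "i \<in> {2..n} \<Longrightarrow> (four_vec i, 4, \<lambda>j. b i * unit_\<beta> i j - unit_\<beta> (i - 1) j) \<in> set smith_triples"
  "(last_vec, 4 * \<bar>b_prod\<bar>, unit_\<beta> n) \<in> set smith_triples"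
proof -
  show "(unit_\<beta> i, 1, \<lambda>j. 2 * unit_\<beta> i j - below i j) \<in> set smith_triples" if "i \<in> {1..n}"
    unfolding smith_triples_def set_append set_map by (rule UnI1, rule image_eqI[where x = i]) (use that in auto)
  show "(unit_diff k, 2, unit_diff k) \<in> set smith_triples" if "k \<in> set unmarked"
    unfolding smith_triples_def set_append set_map
    by (rule UnI2, rule UnI1, rule image_eqI[where x = k]) (use that in auto)
  show "(four_vec i, 4, \<lambda>j. b i * unit_\<beta> i j - unit_\<beta> (i - 1) j) \<in> set smith_triples" if "i \<in> {2..n}"
    unfolding smith_triples_def set_append set_map
    by (rule UnI2, rule UnI2, rule UnI1, rule image_eqI[where x = i]) (use that in auto)
  show "(last_vec, 4 * \<bar>b_prod\<bar>, unit_\<beta> n) \<in> set smith_triples"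
    unfolding smith_triples_def by simp
qed

lemma apply_last_vec:
  assumes "j < N"
  shows "apply_M last_vec j = 4 * \<bar>b_prod\<bar> * unit_\<beta> n j"
proof -
  have "apply_M last_vec j
      = (if b_prod < 0 then -1 else 1) * apply_M (\<lambda>j. \<Sum>i = 1..n. b_partial i * four_vec i j) j"
    using apply_linear[of "if b_prod < 0 then -1 else 1"
      "\<lambda>j. \<Sum>i = 1..n. b_partial i * four_vec i j" 0 last_vec j]
    by (simp add: last_vec_def[abs_def])
  also have "apply_M (\<lambda>j. \<Sum>i = 1..n. b_partial i * four_vec i j) j
      = (\<Sum>i = 1..n. 4 * (b_partial i * (b i * unit_\<beta> i j - unit_\<beta> (i - 1) j)))"
    unfolding apply_sum using assms by (intro sum.cong) (auto simp: apply_four_vec)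
  also have "\<dots> = 4 * (b_partial (Suc n) * unit_\<beta> n j)"
    unfolding b_partial_telescope[symmetric] sum_distrib_left ..
  also have "b_partial (Suc n) = b_prod" by (simp add: b_partial_def b_prod_def atLeastLessThanSuc_atLeastAtMost)
  finally show ?thesis by auto
qed

lemma apply_smith_triples:
  assumes "(f, s, l) \<in> set smith_triples" "j < N"
  shows "apply_M f j = s * l j"
proof -
  have "apply_M (unit_diff k) j = 2 * unit_diff k j" if "k < N" for k
  proof -
    have "apply_M (unit_diff k) j = apply_M (\<lambda>j. of_bool (j = k)) j - apply_M (unit_\<beta> (lev k)) j"
      using apply_linear[of 1 "\<lambda>j. of_bool (j = k)" "-1" "unit_\<beta> (lev k)" j] by (simp add: unit_diff_def[abs_def])
    then show ?thesis
      using apply_unit[OF assms(2) that] apply_unit_\<beta>[OF assms(2), of "lev k"] lev[OF that]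
      by (simp add: unit_diff_def below_def)
  qed
  then show ?thesis
    using assms apply_unit_\<beta> apply_four_vec apply_last_vec by (auto simp: smith_triples_def unmarked_def)
qed

text \<open>The indicator of level \<open>i\<close> differs from \<open>four_vec i\<close> by \<open>\<beta>\<close>-vectors. For \<open>i = 1\<close>, where no triple
  contains \<open>four_vec i\<close>, it is recovered from \<open>last_vec\<close>, in which its coefficient is a unit.\<close>

lemma dom_basis:
  assumes "k < N"
  shows "(\<lambda>j. of_bool (j = k)) \<in> int_span N (map fst smith_triples)"
proof (rule units_in_int_span[OF _ _ _ assms])
  let ?H = "int_span N (map fst smith_triples)"
  have base: "fst t \<in> ?H" if "t \<in> set smith_triples" for t
    using that by (intro int_span_base) simp
  show unit_\<beta>: "unit_\<beta> i \<in> ?H" if "i \<in> {1..n}" for i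
    using base[OF in_set_smith_triples(1)[OF that]] by simp
  show "unit_diff k \<in> ?H" if "k \<in> set unmarked" for k
    using base[OF in_set_smith_triples(2)[OF that]] by simp
  have unit_or_zero: "unit_\<beta> i \<in> ?H" if "i \<le> n" for i
    using unit_\<beta>[of i] that by (cases "i = 0") (auto intro: int_span_zero simp: unit_\<beta>_def)
  have four_vec_ge2: "four_vec i \<in> ?H" if "i \<in> {2..n}" for i
    using base[OF in_set_smith_triples(3)[OF that]] by simp
  have last_vec: "last_vec \<in> ?H" using base[OF in_set_smith_triples(4)] by simp
  have "(\<lambda>j. \<Sum>i = 2..n. b_partial i * four_vec i j) \<in> ?H"
    by (rule int_span_sum) (use four_vec_ge2 in auto)
  with last_vec have four_vec_1: "four_vec 1 \<in> ?H"
  proof (rule int_span_lincomb[where a = "if b_prod < 0 then -1 else 1" and b = "-1"])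
    fix j
    have "(\<Sum>i = 1..n. b_partial i * four_vec i j) = four_vec 1 j + (\<Sum>i = 2..n. b_partial i * four_vec i j)"
      using n_pos by (simp add: sum.atLeast_Suc_atMost b_partial_def numeral_2_eq_2)
    then show "four_vec 1 j = (if b_prod < 0 then -1 else 1) * last_vec j + -1 * (\<Sum>i = 2..n. b_partial i * four_vec i j)"
      by (simp add: last_vec_def)
  qed
  show "level i \<in> ?H" if i: "i \<in> {1..n}" for i
  proof -
    have "four_vec i \<in> ?H" using four_vec_1 four_vec_ge2[of i] i by (cases "i = 1") auto
    moreover have "(\<lambda>j. 2 * b i * unit_\<beta> i j - 2 * unit_\<beta> (i - 1) j) \<in> ?H"
      by (rule int_span_lincomb[where a = "2 * b i" and b = "-2", OF unit_or_zero unit_or_zero]) (use i in auto)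
    ultimately show ?thesis
      by (rule int_span_lincomb[where a = 1 and b = "-1"]) (simp add: four_vec_def)
  qed
qed

text \<open>Starting from \<open>unit_\<beta> n\<close>, the images belonging to the factor 4 express \<open>unit_\<beta> (i - 1)\<close> through
  \<open>unit_\<beta> i\<close>, so the \<open>\<beta>\<close>-vectors are obtained by descending through the levels. The images
  belonging to the factor 1 then yield the vectors \<open>below i\<close>, whose differences are the level indicators.\<close>

lemma cod_basis:
  assumes "k < N"
  shows "(\<lambda>j. of_bool (j = k)) \<in> int_span N (map (snd \<circ> snd) smith_triples)"
proof (rule units_in_int_span[OF _ _ _ assms])
  let ?H = "int_span N (map (snd \<circ> snd) smith_triples)"
  have base: "snd (snd t) \<in> ?H" if "t \<in> set smith_triples" for t
    using that by (intro int_span_base) force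
  show "unit_diff k \<in> ?H" if "k \<in> set unmarked" for k
    using base[OF in_set_smith_triples(2)[OF that]] by simp
  have unit_n: "unit_\<beta> n \<in> ?H" using base[OF in_set_smith_triples(4)] by simp
  have unit_\<beta>: "unit_\<beta> i \<in> ?H" if "i \<le> n" for i
    using that
  proof (induction rule: inc_induct)
    case base
    show ?case by (rule unit_n)
  next
    case (step m)
    show ?case
    proof (cases "m = 0")
      case True
      then show ?thesis by (auto intro: int_span_zero simp: unit_\<beta>_def)
    next
      case False
      then have "(\<lambda>j. b (Suc m) * unit_\<beta> (Suc m) j - unit_\<beta> m j) \<in> ?H"
        using base[OF in_set_smith_triples(3)[of "Suc m"]] step by simp
      from step.IH this show ?thesis
        by (rule int_span_lincomb[where a = "b (Suc m)" and b = "-1"]) simp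
    qed
  qed
  then show "unit_\<beta> i \<in> ?H" if "i \<in> {1..n}" for i using that by simp
  have below: "below i \<in> ?H" if "i \<le> n" for i
  proof (cases "i = 0")
    case True
    then show ?thesis using lev by (intro int_span_zero) (force simp: below_def)
  next
    case False
    then have "(\<lambda>j. 2 * unit_\<beta> i j - below i j) \<in> ?H"
      using base[OF in_set_smith_triples(1)[of i]] that by simp
    with unit_\<beta>[OF that] show ?thesis
      by (rule int_span_lincomb[where a = 2 and b = "-1"]) simp
  qed
  show "level i \<in> ?H" if "i \<in> {1..n}" for i
  proof (rule int_span_lincomb[where a = 1 and b = "-1"])
    show "below i \<in> ?H" "below (i - 1) \<in> ?H" using below that by auto
    show "level i j = 1 * below i j + - 1 * below (i - 1) j" for j
      using that by (auto simp: level_def below_def)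
  qed
qed

lemma is_smith_normal_form_M:
  defines "ds \<equiv> replicate n 1 @ replicate (N - 2 * n) 2 @ replicate (n - 1) 4 @ [4 * \<bar>b_prod\<bar>]"
  shows "is_smith_normal_form M (mat_diag N (\<lambda>i. ds ! i))" "length ds = N"
proof -
  have unmarked: "length unmarked = N - 2 * n" "2 * n \<le> N" using length_unmarked by auto
  have ds: "map (fst \<circ> snd) smith_triples = ds"
    using unmarked(1) by (simp add: smith_triples_def ds_def map_replicate_const o_def del: upt_Suc)
  show "length ds = N" using unmarked n_pos by (simp add: ds_def)
  then have len: "length smith_triples = N" using ds by (metis length_map)
  have nth: "fst (snd (smith_triples ! i)) = ds ! i" if "i < N" for i
    using that len unfolding ds[symmetric] by simp
  have sorted: "sorted_wrt (dvd) ds"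
    by (auto simp: ds_def sorted_wrt_append sorted_wrt_iff_nth_less[of _ "replicate _ _"])
  have "is_smith_normal_form M (mat_diag N (\<lambda>i. fst (snd (smith_triples ! i))))"
  proof (rule smith_normal_form_from_bases)
    show "M \<in> carrier_mat N N" by (simp add: M_def)
    show "(\<Sum>k<N. M $$ (j, k) * f k) = s * l j" if "(f, s, l) \<in> set smith_triples" "j < N" for f s l j
      using apply_smith_triples[OF that] by (simp add: apply_M_def)
    fix i j :: nat assume "i \<le> j" "j < N"
    then show "fst (snd (smith_triples ! i)) dvd fst (snd (smith_triples ! j))"
      using sorted \<open>length ds = N\<close> unfolding sorted_wrt_iff_nth_less
      by (cases "i = j") (auto simp: nth)
  next
    fix i assume i: "i < N"
    have "\<forall>x\<in>set ds. 0 \<le> x" by (auto simp: ds_def)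
    then show "0 \<le> fst (snd (smith_triples ! i))" using i \<open>length ds = N\<close> by (simp add: nth)
  qed (use len dom_basis cod_basis in auto)
  also have "mat_diag N (\<lambda>i. fst (snd (smith_triples ! i))) = mat_diag N (\<lambda>i. ds ! i)"
    by (rule eq_matI) (auto simp: mat_diag_def nth)
  finally show "is_smith_normal_form M (mat_diag N (\<lambda>i. ds ! i))" .
qed

end

section \<open>The power digraph of a cyclic group of prime power order\<close>

text \<open>The powers of \<open>x\<close> in the cyclic group of order \<open>m\<close> are the multiples of \<open>gcd x m\<close>, by Bezout.\<close>

lemma punctured_power_digraph_integer_mod_group:
  assumes "m > 0"
  shows "pverts (punctured_power_digraph (integer_mod_group m)) = {0<..<int m}"
    and "parcs (punctured_power_digraph (integer_mod_group m)) =
      {(x, y). x \<in> {0<..<int m} \<and> y \<in> {0<..<int m} \<and> x \<noteq> y \<and> gcd x (int m) dvd y}"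
proof -
  have V: "carrier (integer_mod_group m) - {\<one>\<^bsub>integer_mod_group m\<^esub>} = {0<..<int m}"
    using assms by (auto simp: carrier_integer_mod_group)
  have cyclic: "(\<exists>k::int. y = x [^]\<^bsub>integer_mod_group m\<^esub> k) \<longleftrightarrow> gcd x (int m) dvd y"
    if y: "y \<in> {0<..<int m}" for x y
  proof
    assume "\<exists>k::int. y = x [^]\<^bsub>integer_mod_group m\<^esub> k"
    then obtain k :: int where "y = (k * x) mod int m" by (auto simp: int_pow_integer_mod_group)
    then show "gcd x (int m) dvd y" by (simp add: dvd_mod)
  next
    assume "gcd x (int m) dvd y"
    then obtain t where t: "y = gcd x (int m) * t" by (elim dvdE)
    obtain u v where "u * x + v * int m = gcd x (int m)" using bezout_int by blast
    then have "y = (t * u) * x + int m * (t * v)" unfolding t by (simp add: algebra_simps flip: distrib_left)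
    then have "y mod int m = ((t * u) * x) mod int m" by simp
    then have "y = ((t * u) * x) mod int m" using y by simp
    then show "\<exists>k::int. y = x [^]\<^bsub>integer_mod_group m\<^esub> k"
      unfolding int_pow_integer_mod_group by blast
  qed
  show "pverts (punctured_power_digraph (integer_mod_group m)) = {0<..<int m}"
    by (simp only: punctured_power_digraph_def Let_def V pair_pre_digraph.simps)
  show "parcs (punctured_power_digraph (integer_mod_group m)) =
      {(x, y). x \<in> {0<..<int m} \<and> y \<in> {0<..<int m} \<and> x \<noteq> y \<and> gcd x (int m) dvd y}"
    unfolding punctured_power_digraph_def Let_def V pair_pre_digraph.simps using cyclic by blast
qed

lemma adjacency_matrix_with_proj:
  assumes "i < length vs" "j < length vs"
  shows "adjacency_matrix (with_proj G) vs $$ (i, j) = of_bool ((vs ! i, vs ! j) \<in> parcs G)"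
proof -
  have "{e \<in> parcs G. fst e = vs ! i \<and> snd e = vs ! j}
      = (if (vs ! i, vs ! j) \<in> parcs G then {(vs ! i, vs ! j)} else {})"
    by auto
  then show ?thesis using assms by (simp add: adjacency_matrix_def)
qed

text \<open>In the cyclic group of order \<open>p ^ n\<close> the element \<open>x\<close> has order \<open>p ^ order_exponent p n x\<close>.\<close>

definition order_exponent :: "nat \<Rightarrow> nat \<Rightarrow> int \<Rightarrow> nat" where
  "order_exponent p n x = n - multiplicity (int p) x"

lemma gcd_prime_power:
  fixes x :: int
  assumes p: "prime p" and x: "x \<in> {0<..<int (p ^ n)}"
  shows "gcd x (int (p ^ n)) = int (p ^ multiplicity (int p) x)" "multiplicity (int p) x < n"
proof -
  have pi: "prime (int p)" using p by simp
  have x0: "x \<noteq> 0" using x by simp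
  show lt: "multiplicity (int p) x < n"
  proof (rule ccontr)
    assume "\<not> multiplicity (int p) x < n"
    then have "int p ^ n dvd x" by (intro multiplicity_dvd') simp
    then have "int (p ^ n) \<le> x" using x by (intro zdvd_imp_le) auto
    then show False using x by simp
  qed
  obtain y where y: "x = int p ^ multiplicity (int p) x * y" "\<not> int p dvd y"
    using multiplicity_decompose'[of x "int p"] x0 prime_gt_1_nat[OF p] by auto
  have "int p ^ n = int p ^ multiplicity (int p) x * int p ^ (n - multiplicity (int p) x)"
    using lt by (simp flip: power_add)
  moreover have "coprime y (int p ^ (n - multiplicity (int p) x))"
    using prime_imp_coprime[OF pi y(2)] by (simp add: coprime_commute)
  ultimately have "gcd x (int p ^ n) = int p ^ multiplicity (int p) x"
    by (subst y(1)) (simp add: gcd_mult_left coprime_imp_gcd_eq_1)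
  then show "gcd x (int (p ^ n)) = int (p ^ multiplicity (int p) x)" by simp
qed

lemma order_exponent_range:
  assumes "prime p" "x \<in> {0<..<int (p ^ n)}"
  shows "order_exponent p n x \<in> {1..n}"
  using gcd_prime_power(2)[OF assms] by (auto simp: order_exponent_def)

text \<open>In a cyclic group of prime power order the subgroups form a chain, so one element generates
  another exactly when its order is at least as large.\<close>

lemma gcd_dvd_iff_order_exponent_le:
  assumes p: "prime p" and x: "x \<in> {0<..<int (p ^ n)}" and y: "y \<in> {0<..<int (p ^ n)}"
  shows "gcd x (int (p ^ n)) dvd y \<longleftrightarrow> order_exponent p n y \<le> order_exponent p n x"
proof -
  have "gcd x (int (p ^ n)) dvd y \<longleftrightarrow> multiplicity (int p) x \<le> multiplicity (int p) y"
    unfolding gcd_prime_power(1)[OF p x] unfolding of_nat_power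
    by (rule power_dvd_iff_le_multiplicity) (use p y in auto)
  then show ?thesis
    using gcd_prime_power(2)[OF p x] gcd_prime_power(2)[OF p y]
    by (auto simp: order_exponent_def)
qed

text \<open>These are the elements of order \<open>p ^ i\<close>, and their number is known from the count of integers
  with a prescribed gcd with \<open>p ^ n\<close>.\<close>

lemma card_order_exponent_eq:
  assumes p: "prime p" and i: "i \<in> {1..n}"
  shows "card {x \<in> {0<..<int (p ^ n)}. order_exponent p n x = i} = totient (p ^ i)"
proof -
  have p1: "p > 1" using prime_gt_1_nat[OF p] .
  have "{x \<in> {0<..<int (p ^ n)}. order_exponent p n x = i}
      = int ` {k \<in> {0<..p ^ n}. gcd k (p ^ n) = p ^ (n - i)}" (is "?L = int ` ?R")
  proof (intro equalityI subsetI)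
    fix x assume "x \<in> ?L"
    then have x: "x \<in> {0<..<int (p ^ n)}" "order_exponent p n x = i" by auto
    then have "gcd x (int (p ^ n)) = int (p ^ (n - i))"
      using gcd_prime_power[OF p x(1)] i by (auto simp: order_exponent_def)
    then have "gcd (nat x) (p ^ n) = p ^ (n - i)"
      using x(1) by (metis gcd_int_int_eq greaterThanLessThan_iff int_nat_eq less_imp_le of_nat_eq_iff)
    then show "x \<in> int ` ?R" using x(1) by (intro image_eqI[of _ _ "nat x"]) (auto simp: nat_le_iff)
  next
    fix x assume "x \<in> int ` ?R"
    then obtain k where k: "x = int k" "k \<in> {0<..p ^ n}" "gcd k (p ^ n) = p ^ (n - i)" by auto
    have "k \<noteq> p ^ n"
      using k(3) i p1 by auto
    then have x: "x \<in> {0<..<int (p ^ n)}" using k by (auto simp flip: of_nat_power)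
    have "int (p ^ multiplicity (int p) x) = gcd (int k) (int (p ^ n))"
      unfolding k(1)[symmetric] by (rule gcd_prime_power(1)[OF p x, symmetric])
    also have "\<dots> = int (p ^ (n - i))" unfolding gcd_int_int_eq k(3) ..
    finally have "p ^ multiplicity (int p) x = p ^ (n - i)" by (simp only: of_nat_eq_iff)
    then have "multiplicity (int p) x = n - i" using p1 by simp
    then show "x \<in> ?L" using x i by (simp add: order_exponent_def)
  qed
  then have "card ?L = card ?R" by (simp add: card_image)
  also have "\<dots> = totient (p ^ n div p ^ (n - i))"
    by (rule card_gcd_eq_totient) (use p1 in \<open>auto simp: le_imp_power_dvd\<close>)
  also have "p ^ n div p ^ (n - i) = p ^ i"
    using p1 i by (simp flip: power_diff)
  finally show ?thesis .
qed

text \<open>Each factor \<open>(2 - \<phi>) 2 ^ (\<phi> - 1)\<close> equals \<open>2 ^ \<phi> (1 - \<phi> / 2)\<close>, and the exponents add up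
  to \<open>p ^ n - 1\<close>. Dividing by \<open>2 ^ (p ^ n - 3)\<close> leaves the factor 4; in particular
  \<open>eta p n\<close> is an integer divisible by 4.\<close>

lemma eta_eq:
  assumes p: "prime p" "p \<ge> 3" and n: "n \<ge> 1"
    and h: "\<And>i. i \<in> {1..n} \<Longrightarrow> totient (p ^ i) = 2 * h i"
    and total: "(\<Sum>i = 1..n. totient (p ^ i)) = p ^ n - 1"
  shows "eta p n = 4 * of_int (\<Prod>i = 1..n. 1 - int (h i))"
proof -
  have "p ^ 1 \<le> p ^ n" using p n by (intro power_increasing) auto
  then have pn: "p ^ n \<ge> 3" using p by simp
  have "(\<Prod>i = 1..n. (2 - of_nat (totient (p ^ i))) * 2 ^ (totient (p ^ i) - 1))
      = (\<Prod>i = 1..n. 2 ^ totient (p ^ i) * of_int (1 - int (h i)) :: rat)"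
  proof (rule prod.cong)
    fix i assume i: "i \<in> {1..n}"
    have "totient (p ^ i) > 0" using p by simp
    then have "2 ^ totient (p ^ i) = (2 :: rat) * 2 ^ (totient (p ^ i) - 1)"
      by (metis Suc_diff_1 power_Suc)
    then show "(2 - of_nat (totient (p ^ i))) * 2 ^ (totient (p ^ i) - 1)
        = 2 ^ totient (p ^ i) * (of_int (1 - int (h i)) :: rat)"
      using h[OF i] by (simp add: algebra_simps)
  qed simp
  also have "\<dots> = 2 ^ (p ^ n - 1) * of_int (\<Prod>i = 1..n. 1 - int (h i))"
    unfolding prod.distrib power_sum[symmetric] total of_int_prod ..
  also have "(2 :: rat) ^ (p ^ n - 1) = 4 * 2 ^ (p ^ n - 3)"
  proof -
    have "p ^ n - 1 = 2 + (p ^ n - 3)" using pn by simp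
    then show ?thesis by (simp only: power_add) simp
  qed
  finally show ?thesis by (simp add: eta_def)
qed

theorem corollary2:
  fixes p n :: nat and vs :: "int list" and A :: "int mat" and ds :: "rat list"
  assumes "prime p" and "p \<ge> 3" and "n \<ge> 1"
    and "distinct vs"
    and "set vs = verts (with_proj (punctured_power_digraph (integer_mod_group (p ^ n))))"
  defines "A \<equiv> adjacency_matrix (with_proj (punctured_power_digraph (integer_mod_group (p ^ n)))) vs"
    and "ds \<equiv> replicate n 1 @ replicate (p ^ n - 2 * n - 1) 2 @ replicate (n - 1) 4 @ [\<bar>eta p n\<bar>]"
  shows "\<exists>S. is_smith_normal_form (1\<^sub>m (p ^ n - 1) - transpose_mat A) S \<and>
             map_mat rat_of_int S = mat_diag (length ds) (\<lambda>i. ds ! i)"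
proof -
  note p = \<open>prime p\<close> and p3 = \<open>p \<ge> 3\<close> and n = \<open>n \<ge> 1\<close>
  define N where "N = p ^ n - 1"
  have "p ^ n > 0" using p3 by simp
  note digraph = punctured_power_digraph_integer_mod_group[OF this]
  have set: "set vs = {0<..<int (p ^ n)}"
    using assms(5) by (simp add: digraph(1))
  have len: "length vs = N"
    using distinct_card[OF \<open>distinct vs\<close>] set by (simp add: N_def nat_diff_distrib del: of_nat_power)
  have mem: "vs ! k \<in> {0<..<int (p ^ n)}" if "k < N" for k
    using that len set by (metis nth_mem)
  have bij: "bij_betw ((!) vs) {..<N} {0<..<int (p ^ n)}"
    using bij_betw_nth[OF \<open>distinct vs\<close>] len set by blast
  \<comment> \<open>The enumeration of the vertices is arbitrary, so the level of an index is that of its vertex.\<close>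
  define lev where "lev = (\<lambda>k. order_exponent p n (vs ! k))"
  define h where "h = (\<lambda>i. totient (p ^ i) div 2)"
  have h: "totient (p ^ i) = 2 * h i" if "i \<in> {1..n}" for i
  proof -
    have "p ^ 1 \<le> p ^ i" using p3 that by (intro power_increasing) auto
    then have "even (totient (p ^ i))" using p3 by (intro totient_even) simp
    then show ?thesis by (simp add: h_def)
  qed
  have lev: "lev k \<in> {1..n}" if "k < N" for k
    unfolding lev_def by (rule order_exponent_range[OF p mem[OF that]])
  have card_lev: "card {k. k < N \<and> lev k = i} = totient (p ^ i)" if "i \<in> {1..n}" for i
  proof -
    have "(!) vs ` {k. k < N \<and> lev k = i} = {x \<in> {0<..<int (p ^ n)}. order_exponent p n x = i}"
      using bij_betw_imp_surj_on[OF bij] by (auto simp: lev_def)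
    moreover have "inj_on ((!) vs) {k. k < N \<and> lev k = i}"
      by (rule inj_on_subset[OF bij_betw_imp_inj_on[OF bij]]) auto
    ultimately have "card {k. k < N \<and> lev k = i} = card {x \<in> {0<..<int (p ^ n)}. order_exponent p n x = i}"
      by (simp only: card_image[symmetric])
    then show ?thesis unfolding card_order_exponent_eq[OF p that] .
  qed
  \<comment> \<open>Since \<open>p\<close> is odd, every level has a positive even number of elements, hence at least two.\<close>
  have "\<exists>r. lev (fst r) = i \<and> fst r < N \<and> lev (snd r) = i \<and> snd r < N \<and> fst r \<noteq> snd r"
    if "i \<in> {1..n}" for i
  proof -
    have "totient (p ^ i) > 0" using p3 by simp
    then have "\<not> card {k. k < N \<and> lev k = i} \<le> Suc 0" using card_lev[OF that] h[OF that] by simp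
    moreover have "finite {k. k < N \<and> lev k = i}" by simp
    ultimately obtain x y where "lev x = i" "x < N" "lev y = i" "y < N" "x \<noteq> y"
      unfolding card_le_Suc0_iff_eq[OF \<open>finite _\<close>] by blast
    then show ?thesis by (intro exI[of _ "(x, y)"]) simp
  qed
  then have "\<forall>i\<in>{1..n}. \<exists>r. lev (fst r) = i \<and> fst r < N \<and> lev (snd r) = i \<and> snd r < N \<and> fst r \<noteq> snd r"
    by blast
  from bchoice[OF this] obtain r where r: "\<forall>i\<in>{1..n}. lev (fst (r i)) = i \<and> fst (r i) < N \<and>
      lev (snd (r i)) = i \<and> snd (r i) < N \<and> fst (r i) \<noteq> snd (r i)"
    by blast
  interpret level_matrix N n lev h "\<lambda>i. fst (r i)" "\<lambda>i. snd (r i)"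
    by standard (use n lev card_lev h r in auto)
  have "(\<Sum>i = 1..n. totient (p ^ i)) = (\<Sum>i = 1..n. card {k. k < N \<and> lev k = i})"
    by (rule sum.cong[OF refl], rule card_lev[symmetric])
  also have "\<dots> = card (\<Union>i\<in>{1..n}. {k. k < N \<and> lev k = i})"
    by (rule card_UN_disjoint[symmetric]) auto
  also have "(\<Union>i\<in>{1..n}. {k. k < N \<and> lev k = i}) = {..<N}" using lev by auto
  finally have "(\<Sum>i = 1..n. totient (p ^ i)) = p ^ n - 1" by (simp add: N_def)
  from eta_eq[OF p p3 n h this] have eta: "eta p n = 4 * of_int b_prod"
    by (simp add: b_prod_def b_def)
  define es where "es = replicate n 1 @ replicate (N - 2 * n) 2 @ replicate (n - 1) 4 @ [4 * \<bar>b_prod\<bar>]"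
  have "1\<^sub>m (p ^ n - 1) - transpose_mat A = M"
  proof (rule eq_matI)
    fix j k assume "j < dim_row M" "k < dim_col M"
    then have jk: "j < N" "k < N" by (auto simp: M_def)
    \<comment> \<open>The digraph has no loops, while \<open>lev j \<le> lev k\<close> also holds for \<open>j = k\<close>; hence the 2 on the diagonal of \<open>M\<close>.\<close>
    have "vs ! k = vs ! j \<longleftrightarrow> j = k"
      using jk len nth_eq_iff_index_eq[OF \<open>distinct vs\<close>] by auto
    then have "(vs ! k, vs ! j) \<in> parcs (punctured_power_digraph (integer_mod_group (p ^ n)))
        \<longleftrightarrow> j \<noteq> k \<and> lev j \<le> lev k"
      using mem jk gcd_dvd_iff_order_exponent_le[OF p mem mem, of k j]
      unfolding digraph(2) lev_def by auto
    then have "transpose_mat A $$ (j, k) = of_bool (j \<noteq> k \<and> lev j \<le> lev k)"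
      using jk len adjacency_matrix_with_proj[of k vs j "punctured_power_digraph (integer_mod_group (p ^ n))"]
      by (simp add: A_def adjacency_matrix_def)
    moreover have "(1\<^sub>m (p ^ n - 1) - transpose_mat A) $$ (j, k) = of_bool (j = k) - transpose_mat A $$ (j, k)"
      unfolding N_def[symmetric] using jk len by (simp add: A_def adjacency_matrix_def)
    moreover have "M $$ (j, k) = 2 * of_bool (j = k) - of_bool (lev j \<le> lev k)"
      using jk by (simp add: M_def)
    ultimately show "(1\<^sub>m (p ^ n - 1) - transpose_mat A) $$ (j, k) = M $$ (j, k)" by auto
  qed (simp_all add: A_def adjacency_matrix_def len M_def flip: N_def)
  then have "is_smith_normal_form (1\<^sub>m (p ^ n - 1) - transpose_mat A) (mat_diag N (\<lambda>i. es ! i))"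
    using is_smith_normal_form_M(1) by (simp add: es_def)
  moreover have "map_mat rat_of_int (mat_diag N (\<lambda>i. es ! i)) = mat_diag (length ds) (\<lambda>i. ds ! i)"
  proof -
    have ds: "ds = map rat_of_int es"
      by (simp add: ds_def es_def eta N_def diff_right_commute)
    have "length es = N" unfolding es_def by (rule is_smith_normal_form_M(2))
    then show ?thesis unfolding ds by (intro eq_matI) (auto simp: mat_diag_def)
  qed
  ultimately show ?thesis by blast
qed

end
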